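(* Let $o\ge 1$ be an integer (fanout), let $h\ge 1$ be an integer (height), and let $\phi_{\mathrm{DY}}=(V,P,V,P,\ldots)$ be the perfectly alternating vector of length $h$. Consider a query $Q$ with selectivities $\varsigma_P,\varsigma_V\in[0,1]$ and its complementary query $Q'$ with selectivities $\varsigma'_P=\varsigma_V$ and $\varsigma'_V=\varsigma_P$. Then no interleaving performs better on average than the dynamic interleaving with the perfectly alternating vector $\phi_{\mathrm{DY}}$; that is, for every admissible vector $\phi=(\phi_1,\ldots,\phi_h)\in\{P,V\}^h$, $$\widehat{C}(o,h,\phi_{\mathrm{DY}},\varsigma_P,\varsigma_V)+\widehat{C}(o,h,\phi_{\mathrm{DY}},\varsigma'_P,\varsigma'_V)\;\le\;\widehat{C}(o,h,\phi,\varsigma_P,\varsigma_V)+\widehat{C}(o,h,\phi,\varsigma'_P,\varsigma'_V).$$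
   Context: Cost model: interleaved keys are organized in a search structure that is a complete tree with fanout $o$ in which every root-to-leaf path has $h$ edges. All nodes on level $i$ partition the data in the same dimension $\phi_i\in\{P,V\}$ ($P$ = path, $V$ = value), so an interleaving is represented by a vector $\phi=(\phi_1,\ldots,\phi_h)\in\{P,V\}^h$. A vector is admissible if it contains equally many $P$s and $V$s (so $h$ is even). A query is a pair $(\varsigma_P,\varsigma_V)\in[0,1]^2$: at each node partitioning in dimension $D$, a search follows a fraction $\varsigma_D$ of the $o$ outgoing branches. The cost of a search (number of visited nodes) is $$\widehat{C}(o,h,\phi,\varsigma_P,\varsigma_V)=1+\sum_{l=1}^{h}\prod_{i=1}^{l}(o\cdot\varsigma_{\phi_i}).$$ The dynamic interleaving corresponds to the vector $\phi_{\mathrm{DY}}=(V,P,V,P,\ldots)$, alternating and starting with $V$. *)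

theory Defs
  imports Complex_Main
begin

text \<open>Partitioning dimensions: path and value. An interleaving is the list of the dimensions
  used on the levels of the search tree; lists are indexed from 0, so the dimension written
  \<open>\<phi>\<^sub>i\<close> mathematically (\<open>1 \<le> i \<le> h\<close>) is \<open>\<phi> ! (i - 1)\<close>.\<close>

datatype dim = P | V

definition interleavings :: "nat \<Rightarrow> dim list set" where
  "interleavings h = {\<phi>. length \<phi> = h}"

definition admissible :: "dim list \<Rightarrow> bool" where
  "admissible \<phi> \<longleftrightarrow> count_list \<phi> P = count_list \<phi> V"

definition selectivity :: "real \<Rightarrow> real \<Rightarrow> dim \<Rightarrow> real" where
  "selectivity s_P s_V d = (case d of P \<Rightarrow> s_P | V \<Rightarrow> s_V)"

text \<open>The number of nodes visited by a search: the root, plus, on each level \<open>l\<close> below it, the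
  product of the (possibly fractional) numbers of branches followed at the levels above.
  Meaningful when \<open>length \<phi> = h\<close>.\<close>

definition cost :: "nat \<Rightarrow> nat \<Rightarrow> dim list \<Rightarrow> real \<Rightarrow> real \<Rightarrow> real" where
  "cost fanout h \<phi> s_P s_V =
     1 + (\<Sum>l = 1..h. \<Prod>i = 1..l. real fanout * selectivity s_P s_V (\<phi> ! (i - 1)))"

definition phi_DY :: "nat \<Rightarrow> dim list" where
  "phi_DY h = map (\<lambda>i. if odd i then V else P) [1..<Suc h]"

end

theory Submission
  imports Defs
begin

text \<open>The inequality holds level by level. Put \<open>a = o * s_P\<close> and \<open>b = o * s_V\<close>. For a prefix with
  \<open>m\<close> levels \<open>P\<close> and \<open>n\<close> levels \<open>V\<close>, the two queries together visit \<open>a^m * b^n + b^m * a^n\<close> nodes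
  on level \<open>m + n\<close>, and for fixed \<open>m + n\<close> this symmetric sum is smallest when \<open>m\<close> and \<open>n\<close> differ
  by at most one, as in every prefix of the alternating vector.\<close>

text \<open>Powers are monotone on nonnegative bases, so both factors have the sign of
  \<open>a - b\<close> or vanish.\<close>

lemma power_diff_mult_nonneg:
  fixes a b :: "'a :: linordered_idom"
  assumes "0 \<le> a" "0 \<le> b"
  shows "0 \<le> (a ^ r - b ^ r) * (a ^ s - b ^ s)"
proof (cases "a \<le> b")
  case True
  with assms show ?thesis by (intro mult_nonpos_nonpos) (auto intro: power_mono)
next
  case False
  with assms show ?thesis by (intro mult_nonneg_nonneg) (auto intro: power_mono)
qed

text \<open>With \<open>p = m + r\<close>, \<open>q = m + s\<close> and
  \<open>n = m + r + s\<close>, right side minus left side factors as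
  \<open>(a * b) ^ m * ((a ^ r - b ^ r) * (a ^ s - b ^ s))\<close>.\<close>

lemma symmetric_power_sum_mono:
  fixes a b :: "'a :: linordered_idom"
  assumes "0 \<le> a" "0 \<le> b" "m \<le> p" "m \<le> q" "m + n = p + q"
  shows "a ^ p * b ^ q + b ^ p * a ^ q \<le> a ^ m * b ^ n + b ^ m * a ^ n"
proof -
  obtain r s where p: "p = m + r" and q: "q = m + s"
    using assms(3,4) by (auto simp: le_iff_add)
  with assms(5) have n: "n = m + r + s" by simp
  have "0 \<le> (a * b) ^ m * ((a ^ r - b ^ r) * (a ^ s - b ^ s))"
    using assms(1,2) by (intro mult_nonneg_nonneg power_diff_mult_nonneg) auto
  then show ?thesis
    by (simp add: p q n power_add power_mult_distrib algebra_simps)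
qed

text \<open>The right side is symmetric in \<open>m\<close> and \<open>n\<close>, and the smaller of
  the two is at most \<open>l div 2\<close>, hence at most both balanced exponents.\<close>

lemma balanced_power_sum_le:
  fixes a b :: "'a :: linordered_idom"
  assumes "0 \<le> a" "0 \<le> b" "m + n = l"
  shows "a ^ (l div 2) * b ^ (Suc l div 2) + b ^ (l div 2) * a ^ (Suc l div 2)
       \<le> a ^ m * b ^ n + b ^ m * a ^ n"
proof (cases "m \<le> n")
  case True
  with assms show ?thesis by (intro symmetric_power_sum_mono) auto
next
  case False
  with assms
  have "a ^ (l div 2) * b ^ (Suc l div 2) + b ^ (l div 2) * a ^ (Suc l div 2)
      \<le> a ^ n * b ^ m + b ^ n * a ^ m"
    by (intro symmetric_power_sum_mono) auto
  then show ?thesis by (simp add: algebra_simps)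
qed

text \<open>The exponents count the \<open>P\<close> and \<open>V\<close> among the first
  \<open>l\<close> levels. They are fixed before \<open>x\<close> and \<open>y\<close>, so that one
  pair serves both a query and its complement.\<close>

lemma prod_selectivity_eq_powers:
  obtains m n where "m + n = l"
    and "\<And>x y. (\<Prod>i = 1..l. c * selectivity x y (\<phi> ! (i - 1))) = (c * x) ^ m * (c * y) ^ n"
proof -
  have "\<exists>m n. m + n = l \<and>
      (\<forall>x y. (\<Prod>i = 1..l. c * selectivity x y (\<phi> ! (i - 1))) = (c * x) ^ m * (c * y) ^ n)"
  proof (induction l)
    case 0
    show ?case by simp
  next
    case (Suc l)
    then obtain m n where mn: "m + n = l"
      and eq: "\<And>x y. (\<Prod>i = 1..l. c * selectivity x y (\<phi> ! (i - 1))) = (c * x) ^ m * (c * y) ^ n"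
      by blast
    show ?case
    proof (cases "\<phi> ! l")
      case P
      with mn eq show ?thesis
        by (intro exI[of _ "Suc m"] exI[of _ n]) (simp add: selectivity_def)
    next
      case V
      with mn eq show ?thesis
        by (intro exI[of _ m] exI[of _ "Suc n"]) (simp add: selectivity_def)
    qed
  qed
  then show thesis using that by blast
qed

text \<open>Since \<open>V\<close> comes first, a prefix of odd length has one more \<open>V\<close>
  than \<open>P\<close>.\<close>

lemma prod_selectivity_phi_DY:
  assumes "l \<le> h"
  shows "(\<Prod>i = 1..l. c * selectivity x y (phi_DY h ! (i - 1)))
       = (c * x) ^ (l div 2) * (c * y) ^ (Suc l div 2)"
  using assms
proof (induction l)
  case 0
  show ?case by simp
next
  case (Suc l)
  \<comment> \<open>Index \<open>l\<close> holds level \<open>l + 1\<close>, so the parity test of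
    \<open>phi_DY_def\<close> is flipped.\<close>
  then have "phi_DY h ! l = (if even l then V else P)"
    by (simp add: phi_DY_def del: upt_Suc)
  with Suc show ?case
    by (cases "even l") (auto simp: selectivity_def elim!: evenE oddE)
qed

theorem theorem1:
  fixes fanout h :: nat
    and s_P s_V s_P' s_V' :: real
    and \<phi> :: "dim list"
  assumes "fanout \<ge> 1"
    and "h \<ge> 1"
    and "s_P \<in> {0..1}"
    and "s_V \<in> {0..1}"
    and "s_P' = s_V"
    and "s_V' = s_P"
    and "\<phi> \<in> interleavings h"
    and "admissible \<phi>"
  shows "cost fanout h (phi_DY h) s_P s_V + cost fanout h (phi_DY h) s_P' s_V'
       \<le> cost fanout h \<phi> s_P s_V + cost fanout h \<phi> s_P' s_V'"
proof -
  define visited where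
    "visited \<psi> l x y = (\<Prod>i = 1..l. real fanout * selectivity x y (\<psi> ! (i - 1)))" for \<psi> l x y
  \<comment> \<open>The constant 2 counts the root once per query.\<close>
  have cost_sum: "cost fanout h \<psi> s_P s_V + cost fanout h \<psi> s_V s_P
      = 2 + (\<Sum>l = 1..h. visited \<psi> l s_P s_V + visited \<psi> l s_V s_P)" for \<psi>
    by (simp add: cost_def visited_def sum.distrib)
  have "visited (phi_DY h) l s_P s_V + visited (phi_DY h) l s_V s_P
      \<le> visited \<phi> l s_P s_V + visited \<phi> l s_V s_P" if "l \<in> {1..h}" for l
  proof -
    obtain m n where "m + n = l"
      and "\<And>x y. visited \<phi> l x y = (real fanout * x) ^ m * (real fanout * y) ^ n"
      unfolding visited_def using prod_selectivity_eq_powers[of l "real fanout" \<phi>] by blast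
    moreover have "visited (phi_DY h) l x y
        = (real fanout * x) ^ (l div 2) * (real fanout * y) ^ (Suc l div 2)" for x y
      unfolding visited_def using that by (intro prod_selectivity_phi_DY) simp
    ultimately show ?thesis
      using balanced_power_sum_le[of "real fanout * s_P" "real fanout * s_V" m n l] assms(3,4)
      by simp
  qed
  then show ?thesis
    unfolding \<open>s_P' = s_V\<close> \<open>s_V' = s_P\<close> cost_sum by (intro add_left_mono sum_mono)
qed

end
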